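(* (Consistency.) In the dagger lambda calculus there exist two terms $t_1,t_2$ of the same type $A$, together with derivable typing judgements $\Gamma\vdash_{S_1}t_1:A$ and $\Gamma\vdash_{S_2}t_2:A$, that can never reduce, under soup reduction, to the same typing judgement.
   Context: The dagger lambda calculus. Types are generated from atomic types by $A^*$ and $A\otimes B$, with $(A^* )^*\equiv A$ and $(A\otimes B)^* := B^*\otimes A^*$; one atomic type $I$, with $I\equiv I^*$, acts as tensor unit. Terms are generated from typed variables and typed constants by $t_*$ and $t\otimes u$; if $t:A$ and $u:B$ then $t_*:A^*$ and $t\otimes u:A\otimes B$; $(t_* )_*\equiv t$ and $(t\otimes u)_* := u_*\otimes t_*$. For each type $A$ there is a constant $D_A:I$, with $D_I=1$ and $1=1_*$. A soup connection $t:u$ (also $t:_A u$) is an ordered pair of terms of the same type $A$, with the identification $t:u\equiv u_*:t_*$ and negation $(t:u)_* := t_*:u_*\equiv u:t$. A soup is a set of connections $\{v_1:v_2,\dots,v_{m-1}:v_m\}$; $S_*$ negates each connection. A typing judgement (sequent) has the form $t_1:A_1,\dots,t_n:A_n\vdash_S t:B$ with $S$ a soup ($\vdash$ means empty soup). A variable is bound if it occurs twice in the judgement (anywhere, including the soup); a term is bound (captured) if it contains no constants and all its variables are bound. $\alpha$-renaming replaces all occurrences of a bound variable by a constant-free term of the same type made of variables not occurring in the judgement, or replaces both occurrences of a bound term occurring twice by a fresh variable of the same type; $\alpha$-equivalence is its reflexive symmetric transitive closure. For $\Delta=t_1:T_1,\dots,t_n:T_n$, $\bigotimes\Delta$ is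 $((t_1\otimes t_2)\otimes\dots)\otimes t_n:((T_1\otimes T_2)\otimes\dots)\otimes T_n$. Judgements are derived by the following rules. Id: $x:A\vdash x:A$. Negation: from $a:A\vdash_S b:B$ infer $a_*:A^*\vdash_{S_*}b_*:B^*$. Cut: from $\Gamma\vdash_{S_1}a:A$ and $a':A,\Delta\vdash_{S_2}b:B$ infer $\Gamma,\Delta\vdash_{S_1\cup S_2\cup\{a:a'\}}b:B$. $\otimes R$: from $\Gamma\vdash_{S_1}a:A$ and $\Delta\vdash_{S_2}b:B$ infer $\Gamma,\bigotimes\Delta\vdash_{S_1\cup S_2}a\otimes b:A\otimes B$. Curry (both directions): $a:A,\Gamma\vdash_S b:B$ iff $\Gamma\vdash_S a_*\otimes b:A^*\otimes B$. $\otimes L$ (both directions): $\Gamma,a:A,b:B\vdash_S c:C$ iff $\Gamma,a\otimes b:A\otimes B\vdash_S c:C$. Exchange: adjacent left-hand terms may be swapped. Unit rules (both directions): $\Gamma\vdash_{S\cup\{i_*:1\}}b:B$ iff $i:I,\Gamma\vdash_S b:B$; and $\Gamma\vdash_{S\cup\{i_*:1\}}b:B$ iff $\Gamma,i:I\vdash_S b:B$. The premises of Cut and $\otimes R$ must share no variables ($\alpha$-rename first if needed), so every variable in a derivable judgement occurs exactly twice (linearity). Constants are introduced by $\vdash 1:I$ and, for a constant $f:A^*\otimes B$, by $a:A\vdash_{\{f:a_*\otimes b\}}b:B$. Soup reduction extends $\alpha$-equivalence by four rules. Bifunctoriality: $S\cup\{a\otimes b:c\otimes d\}\to S\cup\{a:c,b:d\}$.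 Trace: $S\cup\{x:_A x\}\to S\cup\{D_A:1\}$ ($x$ a variable). Cancellation: $S\cup\{1:1\}\to S$. Consumption: $\Gamma\vdash_{S\cup\{t:u\}}b:B\to(\Gamma\vdash_S b:B)[t/u]$ if $u$ contains no constants, or $\to(\Gamma\vdash_S b:B)[u/t]$ if $t$ contains no constants; here $[t/u]$ substitutes $t$ for $u$ throughout the whole judgement (including the soup), and the term substituted for must be one that was captured in the judgement. *)

theory Defs
  imports "HOL-Library.FSet" "HOL-Library.Uprod"
begin

section \<open>Types\<close>

text \<open>
  Types modulo \<open>A** = A\<close>, \<open>(A \<otimes> B)* = B* \<otimes> A*\<close> and \<open>I* = I\<close> are represented by their normal
  forms, in which the dual is pushed down to the atoms; \<open>'a\<close> is the set of atomic types other
  than \<open>I\<close>.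
\<close>

datatype 'a ty =
    Unit
  | Atom 'a
  | DualAtom 'a
  | Tensor "'a ty" "'a ty"

primrec dual :: "'a ty \<Rightarrow> 'a ty" where
  "dual Unit = Unit"
| "dual (Atom a) = DualAtom a"
| "dual (DualAtom a) = Atom a"
| "dual (Tensor A B) = Tensor (dual B) (dual A)"

lemma dual_dual [simp]: "dual (dual A) = A"
  by (induction A) auto


section \<open>Terms\<close>

text \<open>
  Variables carry their type, so that every term has exactly one type and the annotations
  \<open>t : A\<close> in a judgement need not be stored. Named constants are the elements of \<open>'c\<close>, typed by
  a signature \<open>\<kappa> :: 'c \<Rightarrow> 'a ty\<close>. As for types, terms modulo \<open>(t\<^sub>*)\<^sub>* = t\<close> and
  \<open>(t \<otimes> u)\<^sub>* = u\<^sub>* \<otimes> t\<^sub>*\<close> are represented by normal forms.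
\<close>

type_synonym 'a var = "nat \<times> 'a ty"

datatype ('a, 'c) symb =
    Var "'a var"
  | Const 'c
  | Dim "'a ty"

datatype ('a, 'c) trm =
    One
  | Pos "('a, 'c) symb"
  | Neg "('a, 'c) symb"
  | Tens "('a, 'c) trm" "('a, 'c) trm"  (infixl \<open>\<otimes>\<close> 70)

primrec star :: "('a, 'c) trm \<Rightarrow> ('a, 'c) trm" where
  "star One = One"
| "star (Pos h) = Neg h"
| "star (Neg h) = Pos h"
| "star (t \<otimes> u) = star u \<otimes> star t"

lemma star_star [simp]: "star (star t) = t"
  by (induction t) auto

abbreviation var :: "'a var \<Rightarrow> ('a, 'c) trm" where
  "var v \<equiv> Pos (Var v)"

text \<open>
  The constant \<open>D\<^sub>A\<close>. Since \<open>D\<^sub>I = 1\<close>, the symbol \<open>Dim Unit\<close> is never used: constants enter a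
  judgement only through the introduction rules and through \<open>dim\<close>.
\<close>

definition dim :: "'a ty \<Rightarrow> ('a, 'c) trm" where
  "dim A = (if A = Unit then One else Pos (Dim A))"

primrec symb_type :: "('c \<Rightarrow> 'a ty) \<Rightarrow> ('a, 'c) symb \<Rightarrow> 'a ty" where
  "symb_type \<kappa> (Var v) = snd v"
| "symb_type \<kappa> (Const c) = \<kappa> c"
| "symb_type \<kappa> (Dim A) = Unit"

primrec type_of :: "('c \<Rightarrow> 'a ty) \<Rightarrow> ('a, 'c) trm \<Rightarrow> 'a ty" where
  "type_of \<kappa> One = Unit"
| "type_of \<kappa> (Pos h) = symb_type \<kappa> h"
| "type_of \<kappa> (Neg h) = dual (symb_type \<kappa> h)"
| "type_of \<kappa> (t \<otimes> u) = Tensor (type_of \<kappa> t) (type_of \<kappa> u)"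

lemma type_of_star [simp]: "type_of \<kappa> (star t) = dual (type_of \<kappa> t)"
  by (induction t) auto

primrec symb_vars :: "('a, 'c) symb \<Rightarrow> 'a var set" where
  "symb_vars (Var v) = {v}"
| "symb_vars (Const c) = {}"
| "symb_vars (Dim A) = {}"

primrec vars :: "('a, 'c) trm \<Rightarrow> 'a var set" where
  "vars One = {}"
| "vars (Pos h) = symb_vars h"
| "vars (Neg h) = symb_vars h"
| "vars (t \<otimes> u) = vars t \<union> vars u"

primrec constant_free :: "('a, 'c) trm \<Rightarrow> bool" where
  "constant_free One = False"
| "constant_free (Pos h) = (\<exists>v. h = Var v)"
| "constant_free (Neg h) = (\<exists>v. h = Var v)"
| "constant_free (t \<otimes> u) = (constant_free t \<and> constant_free u)"

text \<open>
  An occurrence of \<open>p\<^sub>*\<close> is an occurrence of \<open>p\<close>, and replacing \<open>p\<close> by \<open>r\<close> replaces \<open>p\<^sub>*\<close> by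
  \<open>r\<^sub>*\<close>. \<open>subst p r t\<close> is \<open>t[r/p]\<close>.
\<close>

fun occ :: "('a, 'c) trm \<Rightarrow> ('a, 'c) trm \<Rightarrow> nat" where
  "occ p t =
    (if t = p \<or> t = star p then 1
     else case t of u \<otimes> v \<Rightarrow> occ p u + occ p v | _ \<Rightarrow> 0)"

fun subst :: "('a, 'c) trm \<Rightarrow> ('a, 'c) trm \<Rightarrow> ('a, 'c) trm \<Rightarrow> ('a, 'c) trm" where
  "subst p r t =
    (if t = p then r
     else if t = star p then star r
     else case t of u \<otimes> v \<Rightarrow> subst p r u \<otimes> subst p r v | _ \<Rightarrow> t)"

declare occ.simps [simp del] subst.simps [simp del]

lemma star_eq_iff: "star t = u \<longleftrightarrow> t = star u"
  by auto

lemma occ_star: "occ p (star t) = occ p t"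
proof (induction t)
  case (Tens t u)
  have "star (t \<otimes> u) = p \<or> star (t \<otimes> u) = star p \<longleftrightarrow> t \<otimes> u = p \<or> t \<otimes> u = star p"
    by (metis star_star)
  then show ?case
    using Tens by (auto simp: occ.simps[of p "t \<otimes> u"] occ.simps[of p "star u \<otimes> star t"])
qed (auto simp: occ.simps star_eq_iff dest: sym)

text \<open>
  Replacement commutes with negation unless \<open>p = p\<^sub>*\<close>, as for \<open>p = x \<otimes> x\<^sub>*\<close>; such a \<open>p\<close> has no
  second occurrence in a linear judgement.
\<close>

lemma subst_star: "star p \<noteq> p \<Longrightarrow> subst p r (star t) = star (subst p r t)"
proof (induction t)
  case (Tens t u)
  have "star (t \<otimes> u) = p \<longleftrightarrow> t \<otimes> u = star p" "star (t \<otimes> u) = star p \<longleftrightarrow> t \<otimes> u = p"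
    by (metis star_star)+
  then show ?case
    using Tens by (auto simp: subst.simps[of p r "t \<otimes> u"] subst.simps[of p r "star u \<otimes> star t"])
qed (auto simp: subst.simps star_eq_iff dest: sym)

definition linear_trm :: "('a, 'c) trm \<Rightarrow> bool" where
  "linear_trm t \<longleftrightarrow> (\<forall>v \<in> vars t. occ (var v) t = 1)"

definition bigtensor :: "('a, 'c) trm list \<Rightarrow> ('a, 'c) trm" where
  "bigtensor \<Delta> = foldl (\<otimes>) (hd \<Delta>) (tl \<Delta>)"


section \<open>Soups and judgements\<close>

text \<open>
  The connection \<open>t : u\<close> is represented by the unordered pair of \<open>t\<close> and \<open>u\<^sub>*\<close>. This makes exactly
  the identification \<open>t : u \<equiv> u\<^sub>* : t\<^sub>*\<close>, see \<open>conn_eq_iff\<close> below.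
\<close>

type_synonym ('a, 'c) connection = "('a, 'c) trm uprod"

definition conn :: "('a, 'c) trm \<Rightarrow> ('a, 'c) trm \<Rightarrow> ('a, 'c) connection" where
  "conn t u = Upair t (star u)"

lemma conn_eq_iff: "conn t u = conn t' u' \<longleftrightarrow> (t' = t \<and> u' = u) \<or> (t' = star u \<and> u' = star t)"
  unfolding conn_def by (metis Upair_inject star_star)

definition conn_neg :: "('a, 'c) connection \<Rightarrow> ('a, 'c) connection" where
  "conn_neg c = map_uprod star c"

lemma conn_neg_conn: "conn_neg (conn t u) = conn (star t) (star u)"
  by (simp add: conn_neg_def conn_def)

lift_definition conn_occ :: "('a, 'c) trm \<Rightarrow> ('a, 'c) connection \<Rightarrow> nat"
  is "\<lambda>p (t, u). occ p t + occ p u"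
  by (auto simp: eq_upair_def)

lemma conn_occ_conn: "conn_occ p (conn t u) = occ p t + occ p u"
  unfolding conn_def by transfer (simp add: occ_star)

lemma conn_subst_conn:
  "star p \<noteq> p \<Longrightarrow> map_uprod (subst p r) (conn t u) = conn (subst p r t) (subst p r u)"
  by (simp add: conn_def subst_star)

type_synonym ('a, 'c) soup = "('a, 'c) connection fset"

datatype ('a, 'c) judgement =
  Judgement "('a, 'c) trm list" "('a, 'c) soup" "('a, 'c) trm"
    (\<open>_ \<turnstile>\<^bsub>_\<^esub> _\<close> [51, 0, 51] 50)

primrec jdg_occ :: "('a, 'c) trm \<Rightarrow> ('a, 'c) judgement \<Rightarrow> nat" where
  "jdg_occ p (\<Gamma> \<turnstile>\<^bsub>S\<^esub> b) = sum_list (map (occ p) \<Gamma>) + (\<Sum>c \<in> fset S. conn_occ p c) + occ p b"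

primrec jdg_vars :: "('a, 'c) judgement \<Rightarrow> 'a var set" where
  "jdg_vars (\<Gamma> \<turnstile>\<^bsub>S\<^esub> b) =
    \<Union> (vars ` set \<Gamma>) \<union> (\<Union>c \<in> fset S. \<Union> (vars ` set_uprod c)) \<union> vars b"

primrec jdg_subst ::
  "('a, 'c) trm \<Rightarrow> ('a, 'c) trm \<Rightarrow> ('a, 'c) judgement \<Rightarrow> ('a, 'c) judgement" where
  "jdg_subst p r (\<Gamma> \<turnstile>\<^bsub>S\<^esub> b) =
    (map (subst p r) \<Gamma> \<turnstile>\<^bsub>map_uprod (subst p r) |`| S\<^esub> subst p r b)"

definition bound :: "('a, 'c) judgement \<Rightarrow> 'a var \<Rightarrow> bool" where
  "bound J v \<longleftrightarrow> jdg_occ (var v) J = 2"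

definition captured :: "('a, 'c) judgement \<Rightarrow> ('a, 'c) trm \<Rightarrow> bool" where
  "captured J p \<longleftrightarrow> constant_free p \<and> (\<forall>v \<in> vars p. bound J v)"


section \<open>\<open>\<alpha>\<close>-equivalence\<close>

text \<open>
  The term replacing a variable is required to be linear, as otherwise \<open>\<alpha>\<close>-renaming would destroy
  the linearity of judgements.
\<close>

inductive alpha_step ::
  "('c \<Rightarrow> 'a ty) \<Rightarrow> ('a, 'c) judgement \<Rightarrow> ('a, 'c) judgement \<Rightarrow> bool" for \<kappa> where
  expand:
    "\<lbrakk>bound J v; constant_free p; linear_trm p; type_of \<kappa> p = snd v; vars p \<inter> jdg_vars J = {}\<rbrakk>
     \<Longrightarrow> alpha_step \<kappa> J (jdg_subst (var v) p J)"
| contract: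
    "\<lbrakk>captured J p; jdg_occ p J = 2; type_of \<kappa> p = snd v; v \<notin> jdg_vars J\<rbrakk>
     \<Longrightarrow> alpha_step \<kappa> J (jdg_subst p (var v) J)"

definition alpha_equiv ::
  "('c \<Rightarrow> 'a ty) \<Rightarrow> ('a, 'c) judgement \<Rightarrow> ('a, 'c) judgement \<Rightarrow> bool" where
  "alpha_equiv \<kappa> = equivclp (alpha_step \<kappa>)"


section \<open>Derivable judgements\<close>

text \<open>
  Where a premise has the form \<open>S \<union> {c}\<close> and \<open>c\<close> is removed by the rule, \<open>S\<close> does not contain
  \<open>c\<close>. In \<open>tensorR\<close> the context \<open>\<Delta>\<close> is nonempty since \<open>bigtensor \<Delta>\<close> makes sense only then.
  The rule \<open>Alpha\<close> is what allows premises of \<open>Cut\<close> and \<open>tensorR\<close> to be renamed apart.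
\<close>

inductive derivable :: "('c \<Rightarrow> 'a ty) \<Rightarrow> ('a, 'c) judgement \<Rightarrow> bool" for \<kappa> where
  Id: "derivable \<kappa> ([var x] \<turnstile>\<^bsub>{||}\<^esub> var x)"
| Negation:
    "derivable \<kappa> ([a] \<turnstile>\<^bsub>S\<^esub> b) \<Longrightarrow> derivable \<kappa> ([star a] \<turnstile>\<^bsub>conn_neg |`| S\<^esub> star b)"
| Cut:
    "\<lbrakk>derivable \<kappa> (\<Gamma> \<turnstile>\<^bsub>S1\<^esub> a); derivable \<kappa> (a' # \<Delta> \<turnstile>\<^bsub>S2\<^esub> b); type_of \<kappa> a = type_of \<kappa> a';
      jdg_vars (\<Gamma> \<turnstile>\<^bsub>S1\<^esub> a) \<inter> jdg_vars (a' # \<Delta> \<turnstile>\<^bsub>S2\<^esub> b) = {}\<rbrakk>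
     \<Longrightarrow> derivable \<kappa> (\<Gamma> @ \<Delta> \<turnstile>\<^bsub>S1 |\<union>| S2 |\<union>| {|conn a a'|}\<^esub> b)"
| tensorR:
    "\<lbrakk>derivable \<kappa> (\<Gamma> \<turnstile>\<^bsub>S1\<^esub> a); derivable \<kappa> (\<Delta> \<turnstile>\<^bsub>S2\<^esub> b); \<Delta> \<noteq> [];
      jdg_vars (\<Gamma> \<turnstile>\<^bsub>S1\<^esub> a) \<inter> jdg_vars (\<Delta> \<turnstile>\<^bsub>S2\<^esub> b) = {}\<rbrakk>
     \<Longrightarrow> derivable \<kappa> (\<Gamma> @ [bigtensor \<Delta>] \<turnstile>\<^bsub>S1 |\<union>| S2\<^esub> a \<otimes> b)"
| curry:
    "derivable \<kappa> (a # \<Gamma> \<turnstile>\<^bsub>S\<^esub> b) \<Longrightarrow> derivable \<kappa> (\<Gamma> \<turnstile>\<^bsub>S\<^esub> star a \<otimes> b)"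
| uncurry:
    "derivable \<kappa> (\<Gamma> \<turnstile>\<^bsub>S\<^esub> star a \<otimes> b) \<Longrightarrow> derivable \<kappa> (a # \<Gamma> \<turnstile>\<^bsub>S\<^esub> b)"
| tensorL:
    "derivable \<kappa> (\<Gamma> @ [a, b] \<turnstile>\<^bsub>S\<^esub> c) \<Longrightarrow> derivable \<kappa> (\<Gamma> @ [a \<otimes> b] \<turnstile>\<^bsub>S\<^esub> c)"
| tensorL_inv:
    "derivable \<kappa> (\<Gamma> @ [a \<otimes> b] \<turnstile>\<^bsub>S\<^esub> c) \<Longrightarrow> derivable \<kappa> (\<Gamma> @ [a, b] \<turnstile>\<^bsub>S\<^esub> c)"
| Exchange:
    "derivable \<kappa> (\<Gamma> @ [a, b] @ \<Delta> \<turnstile>\<^bsub>S\<^esub> c) \<Longrightarrow> derivable \<kappa> (\<Gamma> @ [b, a] @ \<Delta> \<turnstile>\<^bsub>S\<^esub> c)"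
| unitL:
    "\<lbrakk>derivable \<kappa> (\<Gamma> \<turnstile>\<^bsub>S |\<union>| {|conn (star i) One|}\<^esub> b); type_of \<kappa> i = Unit;
      conn (star i) One |\<notin>| S\<rbrakk>
     \<Longrightarrow> derivable \<kappa> (i # \<Gamma> \<turnstile>\<^bsub>S\<^esub> b)"
| unitL_inv:
    "\<lbrakk>derivable \<kappa> (i # \<Gamma> \<turnstile>\<^bsub>S\<^esub> b); type_of \<kappa> i = Unit\<rbrakk>
     \<Longrightarrow> derivable \<kappa> (\<Gamma> \<turnstile>\<^bsub>S |\<union>| {|conn (star i) One|}\<^esub> b)"
| unitR:
    "\<lbrakk>derivable \<kappa> (\<Gamma> \<turnstile>\<^bsub>S |\<union>| {|conn (star i) One|}\<^esub> b); type_of \<kappa> i = Unit;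
      conn (star i) One |\<notin>| S\<rbrakk>
     \<Longrightarrow> derivable \<kappa> (\<Gamma> @ [i] \<turnstile>\<^bsub>S\<^esub> b)"
| unitR_inv:
    "\<lbrakk>derivable \<kappa> (\<Gamma> @ [i] \<turnstile>\<^bsub>S\<^esub> b); type_of \<kappa> i = Unit\<rbrakk>
     \<Longrightarrow> derivable \<kappa> (\<Gamma> \<turnstile>\<^bsub>S |\<union>| {|conn (star i) One|}\<^esub> b)"
| One_intro: "derivable \<kappa> ([] \<turnstile>\<^bsub>{||}\<^esub> One)"
| Const_intro:
    "\<lbrakk>\<kappa> f = Tensor (dual A) B; snd a = A; snd b = B; a \<noteq> b\<rbrakk>
     \<Longrightarrow> derivable \<kappa> ([var a] \<turnstile>\<^bsub>{|conn (Pos (Const f)) (star (var a) \<otimes> var b)|}\<^esub> var b)"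
| Alpha: "\<lbrakk>derivable \<kappa> J; alpha_equiv \<kappa> J J'\<rbrakk> \<Longrightarrow> derivable \<kappa> J'"


section \<open>Soup reduction\<close>

text \<open>
  As above, the connection acted upon is not an element of the remaining soup \<open>S\<close>. Consumption
  asks that the replaced term be captured in the judgement before the step, and does not ask that
  it occur outside the consumed connection; this only makes the relation larger.
\<close>

inductive soup_step ::
  "('c \<Rightarrow> 'a ty) \<Rightarrow> ('a, 'c) judgement \<Rightarrow> ('a, 'c) judgement \<Rightarrow> bool" for \<kappa> where
  alpha: "alpha_equiv \<kappa> J J' \<Longrightarrow> soup_step \<kappa> J J'"
| bifunctoriality:
    "conn (a \<otimes> b) (c \<otimes> d) |\<notin>| S
     \<Longrightarrow> soup_step \<kappa> (\<Gamma> \<turnstile>\<^bsub>S |\<union>| {|conn (a \<otimes> b) (c \<otimes> d)|}\<^esub> e) (\<Gamma> \<turnstile>\<^bsub>S |\<union>| {|conn a c, conn b d|}\<^esub> e)"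
| trace:
    "\<lbrakk>conn (var x) (var x) |\<notin>| S; snd x = A\<rbrakk>
     \<Longrightarrow> soup_step \<kappa> (\<Gamma> \<turnstile>\<^bsub>S |\<union>| {|conn (var x) (var x)|}\<^esub> e) (\<Gamma> \<turnstile>\<^bsub>S |\<union>| {|conn (dim A) One|}\<^esub> e)"
| cancellation:
    "conn One One |\<notin>| S \<Longrightarrow> soup_step \<kappa> (\<Gamma> \<turnstile>\<^bsub>S |\<union>| {|conn One One|}\<^esub> e) (\<Gamma> \<turnstile>\<^bsub>S\<^esub> e)"
| consumption1:
    "\<lbrakk>conn t u |\<notin>| S; constant_free u; captured (\<Gamma> \<turnstile>\<^bsub>S |\<union>| {|conn t u|}\<^esub> e) u\<rbrakk>
     \<Longrightarrow> soup_step \<kappa> (\<Gamma> \<turnstile>\<^bsub>S |\<union>| {|conn t u|}\<^esub> e) (jdg_subst u t (\<Gamma> \<turnstile>\<^bsub>S\<^esub> e))"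
| consumption2:
    "\<lbrakk>conn t u |\<notin>| S; constant_free t; captured (\<Gamma> \<turnstile>\<^bsub>S |\<union>| {|conn t u|}\<^esub> e) t\<rbrakk>
     \<Longrightarrow> soup_step \<kappa> (\<Gamma> \<turnstile>\<^bsub>S |\<union>| {|conn t u|}\<^esub> e) (jdg_subst t u (\<Gamma> \<turnstile>\<^bsub>S\<^esub> e))"

definition reduces ::
  "('c \<Rightarrow> 'a ty) \<Rightarrow> ('a, 'c) judgement \<Rightarrow> ('a, 'c) judgement \<Rightarrow> bool" where
  "reduces \<kappa> = (soup_step \<kappa>)\<^sup>*\<^sup>*"

end

theory Submission
  imports Defs
begin

text \<open>
  For an atom \<open>A\<close>, the judgements \<open>x : A, y : A \<turnstile> x \<otimes> y\<close> and \<open>x : A, y : A \<turnstile> y \<otimes> x\<close> have an empty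
  soup, so that only \<open>\<alpha>\<close>-equivalence applies to them. A term of atomic type without constants is a
  variable or a negated variable, hence \<open>\<alpha>\<close>-equivalence, in either direction, only renames \<open>x\<close> and
  \<open>y\<close>, and never identifies them.
\<close>

lemma vars_star [simp]: "vars (star t) = vars t"
  by (induction t) auto

lemma constant_free_star [simp]: "constant_free (star t) \<longleftrightarrow> constant_free t"
  by (induction t) auto

lemma constant_free_vars_nonempty: "constant_free t \<Longrightarrow> vars t \<noteq> {}"
  by (induction t) auto

lemma constant_free_atomic:
  assumes "constant_free t" and "type_of \<kappa> t = Atom \<alpha> \<or> type_of \<kappa> t = DualAtom \<alpha>"
  obtains v where "t = Pos (Var v)" | v where "t = Neg (Var v)"
  using assms by (cases t) auto

text \<open>
  Expansion and contraction are instances of a single scheme, in which \<open>p\<close> or \<open>r\<close>, respectively,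
  is a variable.
\<close>

lemma alpha_stepE:
  assumes "alpha_step \<kappa> J J'"
  obtains p r where "J' = jdg_subst p r J" "constant_free p" "constant_free r"
    "type_of \<kappa> p = type_of \<kappa> r" "jdg_occ p J = 2" "vars r \<inter> jdg_vars J = {}"
  using assms
proof cases
  case (expand v p)
  then show ?thesis by (intro that[of "var v" p]) (auto simp: bound_def)
next
  case (contract p v)
  then show ?thesis by (intro that[of p "var v"]) (auto simp: captured_def)
qed

lemma occ_constructors:
  "occ p (Pos h) = (if p = Pos h \<or> p = Neg h then 1 else 0)"
  "occ p (Neg h) = (if p = Pos h \<or> p = Neg h then 1 else 0)"
  "occ p (t \<otimes> u) =
    (if p = t \<otimes> u \<or> p = star u \<otimes> star t then 1 else occ p t + occ p u)"
  using star_eq_iff[of p "Pos h"] star_eq_iff[of p "Neg h"] star_eq_iff[of p "t \<otimes> u"]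
  by (auto simp: occ.simps[of p "Pos h"] occ.simps[of p "Neg h"]
      occ.simps[of p "t \<otimes> u"])

text \<open>A literal is a variable or constant symbol with either sign. Keeping the sign open lets
  later arguments avoid a split on the signs of both context terms.\<close>

lemma occ_literal:
  "a = Pos h \<or> a = Neg h \<Longrightarrow> occ p a = (if a = p \<or> a = star p then 1 else 0)"
  by (auto simp: occ.simps[of p a])

lemma subst_literal:
  "a = Pos h \<or> a = Neg h \<Longrightarrow>
    subst p r a = (if a = p then r else if a = star p then star r else a)"
  by (auto simp: subst.simps[of p r a])

lemma subst_Tens:
  "p \<noteq> t \<otimes> u \<Longrightarrow> p \<noteq> star u \<otimes> star t \<Longrightarrow> subst p r (t \<otimes> u) = subst p r t \<otimes> subst p r u"
  using star_eq_iff[of p "t \<otimes> u"] by (auto simp: subst.simps[of p r "t \<otimes> u"])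

text \<open>The invariant of reduction. The flag lets one preservation proof serve both orders. The
  components are general terms rather than variables because renaming may turn a variable of type
  \<open>Atom \<alpha>\<close> into the negation of one of type
  \<open>DualAtom \<alpha>\<close>.\<close>

definition pairing ::
  "('c \<Rightarrow> 'a ty) \<Rightarrow> 'a \<Rightarrow> bool \<Rightarrow> ('a, 'c) judgement \<Rightarrow> bool" where
  "pairing \<kappa> \<alpha> swapped J \<longleftrightarrow>
    (\<exists>a b. J = ([a, b] \<turnstile>\<^bsub>{||}\<^esub> (if swapped then b \<otimes> a else a \<otimes> b)) \<and>
      constant_free a \<and> constant_free b \<and>
      type_of \<kappa> a = Atom \<alpha> \<and> type_of \<kappa> b = Atom \<alpha> \<and> vars a \<inter> vars b = {})"

lemma pairing_alpha_step:
  assumes "alpha_step \<kappa> J J'" and "pairing \<kappa> \<alpha> s J"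
  shows "pairing \<kappa> \<alpha> s J'"
proof -
  obtain p r where J': "J' = jdg_subst p r J" and cf: "constant_free p" "constant_free r"
    and ty: "type_of \<kappa> p = type_of \<kappa> r" and occ: "jdg_occ p J = 2"
    and fresh: "vars r \<inter> jdg_vars J = {}"
    using assms(1) by (rule alpha_stepE)
  obtain a b where J: "J = ([a, b] \<turnstile>\<^bsub>{||}\<^esub> (if s then b \<otimes> a else a \<otimes> b))"
    and ab: "constant_free a" "constant_free b" "type_of \<kappa> a = Atom \<alpha>" "type_of \<kappa> b = Atom \<alpha>"
      "vars a \<inter> vars b = {}"
    using assms(2) unfolding pairing_def by blast
  obtain u v where lit: "a = Pos (Var u) \<or> a = Neg (Var u)" "b = Pos (Var v) \<or> b = Neg (Var v)"
    using ab(1-4) by (meson constant_free_atomic)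
  have uv: "u \<noteq> v"
    using lit ab(5) by auto
  \<comment> \<open>The whole tensor occurs just once, so a count of two leaves only the two
    literals, up to sign.\<close>
  have p: "p = a \<or> p = star a \<or> p = b \<or> p = star b"
    using occ lit unfolding J by (auto simp: occ_constructors split: if_splits)
  then have "type_of \<kappa> r = Atom \<alpha> \<or> type_of \<kappa> r = DualAtom \<alpha>"
    using ty ab by auto
  then obtain w where r: "r = Pos (Var w) \<or> r = Neg (Var w)"
    using cf(2) by (meson constant_free_atomic)
  have w: "w \<noteq> u" "w \<noteq> v"
    using fresh r lit unfolding J by auto
  have "subst p r (if s then b \<otimes> a else a \<otimes> b) =
    (if s then subst p r b \<otimes> subst p r a else subst p r a \<otimes> subst p r b)"
    using p lit by (auto intro!: subst_Tens)
  moreover have "constant_free (subst p r a) \<and> constant_free (subst p r b) \<and>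
    type_of \<kappa> (subst p r a) = Atom \<alpha> \<and> type_of \<kappa> (subst p r b) = Atom \<alpha> \<and>
    vars (subst p r a) \<inter> vars (subst p r b) = {}"
  proof -
    have ne: "a \<noteq> b" "a \<noteq> star b" "b \<noteq> star a" "a \<noteq> star a" "b \<noteq> star b"
      using lit uv by auto
    have vs: "vars a = {u}" "vars b = {v}" "vars r = {w}"
      using lit r by auto
    \<comment> \<open>If \<open>p\<close> is a negated component, \<open>r\<close> has the dual
      type, but that component is then replaced by \<open>star r\<close>, which is again of type
      \<open>Atom \<alpha>\<close>.\<close>
    have r_type: "type_of \<kappa> r = (if p = a \<or> p = b then Atom \<alpha> else DualAtom \<alpha>)"
      using p ty ab by auto
    show ?thesis
      using p
      by (elim disjE) (use ne vs r_type w uv ab cf(2) in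
          \<open>simp_all add: subst_literal[OF lit(1)] subst_literal[OF lit(2)]\<close>)
  qed
  ultimately show ?thesis
    unfolding J' J pairing_def by auto
qed

lemma subst_eq_literalD:
  assumes "subst p r t = a" "a = Pos h \<or> a = Neg h"
  shows "t = p \<and> r = a \<or> t = star p \<and> r = star a \<or> t \<noteq> p \<and> t \<noteq> star p \<and> t = a"
  using assms unfolding subst.simps[of p r t]
  by (cases t) (auto simp: star_eq_iff split: if_splits)

lemma subst_eq_TensD:
  assumes "subst p r t = a \<otimes> b"
  shows "(t = p \<and> r = a \<otimes> b) \<or> (t = star p \<and> r = star b \<otimes> star a) \<or>
    (\<exists>c d. t = c \<otimes> d \<and> t \<noteq> p \<and> t \<noteq> star p \<and> subst p r c = a \<and> subst p r d = b)"
  using assms unfolding subst.simps[of p r t]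
  by (cases t) (auto simp: star_eq_iff split: if_splits)

text \<open>Here only the shape of the result is known. The count of \<open>p\<close> forces a
  replacement to have happened, so \<open>r\<close> is a component up to sign; freshness of
  \<open>r\<close> then forces every place showing that component to come from
  \<open>p\<close>.\<close>

lemma pairing_alpha_step_rev:
  assumes "alpha_step \<kappa> J J'" and "pairing \<kappa> \<alpha> s J'"
  shows "pairing \<kappa> \<alpha> s J"
proof -
  obtain p r where J': "J' = jdg_subst p r J" and cf: "constant_free p" "constant_free r"
    and ty: "type_of \<kappa> p = type_of \<kappa> r" and occ: "jdg_occ p J = 2"
    and fresh: "vars r \<inter> jdg_vars J = {}"
    using assms(1) by (rule alpha_stepE)
  obtain a b where J'_eq: "J' = ([a, b] \<turnstile>\<^bsub>{||}\<^esub> (if s then b \<otimes> a else a \<otimes> b))"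
    and ab: "constant_free a" "constant_free b" "type_of \<kappa> a = Atom \<alpha>" "type_of \<kappa> b = Atom \<alpha>"
      "vars a \<inter> vars b = {}"
    using assms(2) unfolding pairing_def by blast
  obtain u v where lit: "a = Pos (Var u) \<or> a = Neg (Var u)" "b = Pos (Var v) \<or> b = Neg (Var v)"
    using ab(1-4) by (meson constant_free_atomic)
  have uv: "u \<noteq> v"
    using lit ab(5) by auto
  obtain t1 t2 t3 where J: "J = ([t1, t2] \<turnstile>\<^bsub>{||}\<^esub> t3)"
    and t12: "subst p r t1 = a" "subst p r t2 = b"
    and t3: "subst p r t3 = (if s then b \<otimes> a else a \<otimes> b)"
    using J' J'_eq by (cases J) (auto simp: map_eq_Cons_conv)
  note t1_cases = subst_eq_literalD[OF t12(1) lit(1)]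
  note t2_cases = subst_eq_literalD[OF t12(2) lit(2)]
  \<comment> \<open>Otherwise \<open>t1\<close> would be an untouched \<open>a\<close>, which shares
    its variable with \<open>r\<close>, against freshness.\<close>
  have "r \<noteq> a \<otimes> b" "r \<noteq> b \<otimes> a" "r \<noteq> star b \<otimes> star a" "r \<noteq> star a \<otimes> star b"
    using t1_cases fresh constant_free_vars_nonempty[OF ab(1)] lit unfolding J by auto
  then obtain c d where t3_eq: "t3 = (if s then d \<otimes> c else c \<otimes> d)" "t3 \<noteq> p" "t3 \<noteq> star p"
    and cd: "subst p r c = a" "subst p r d = b"
    using t3 by (cases s) (auto dest!: subst_eq_TensD)
  note c_cases = subst_eq_literalD[OF cd(1) lit(1)]
  note d_cases = subst_eq_literalD[OF cd(2) lit(2)]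
  have occ': "occ p t1 + occ p t2 + occ p c + occ p d = 2"
    using occ t3_eq unfolding J
    by (cases s) (simp_all add: occ.simps[of p "c \<otimes> d"] occ.simps[of p "d \<otimes> c"])
  \<comment> \<open>If \<open>r\<close> were none of these, nothing was replaced and
    \<open>p\<close> would occur zero times instead of twice.\<close>
  have r: "r = a \<or> r = star a \<or> r = b \<or> r = star b"
  proof (rule ccontr)
    assume "\<not> ?thesis"
    then have "t1 = a" "c = a" "t2 = b" "d = b" "a \<noteq> p" "a \<noteq> star p" "b \<noteq> p" "b \<noteq> star p"
      using t1_cases t2_cases c_cases d_cases by blast+
    then have "occ p t1 = 0" "occ p t2 = 0" "occ p c = 0" "occ p d = 0"
      by (simp_all add: occ_literal[OF lit(1)] occ_literal[OF lit(2)])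
    with occ' show False by simp
  qed
  then obtain w where p: "p = Pos (Var w) \<or> p = Neg (Var w)"
    using cf(1) ty ab by (metis constant_free_atomic dual.simps(2) type_of_star)
  have wu: "r = a \<or> r = star a \<Longrightarrow> u \<notin> vars t1 \<union> vars t2 \<union> vars c \<union> vars d"
    and wv: "r = b \<or> r = star b \<Longrightarrow> v \<notin> vars t1 \<union> vars t2 \<union> vars c \<union> vars d"
    using fresh lit unfolding J t3_eq(1) by (cases s; force)+
  have vars_ab: "vars a = {u}" "vars b = {v}" "vars p = {w}"
    using lit p by auto
  consider "r = a \<or> r = star a" | "r = b \<or> r = star b"
    using r by blast
  then have "t1 = c \<and> t2 = d \<and> constant_free t1 \<and> constant_free t2 \<and>
    type_of \<kappa> t1 = Atom \<alpha> \<and> type_of \<kappa> t2 = Atom \<alpha> \<and> vars t1 \<inter> vars t2 = {}"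
  proof cases
    case 1
    \<comment> \<open>By \<open>wu\<close> neither \<open>t1\<close> nor \<open>c\<close> can be an
      untouched \<open>a\<close>, so both come from \<open>p\<close> with the same sign.\<close>
    have t1: "t1 = (if r = a then p else star p)" "c = t1"
      using 1 t1_cases c_cases wu vars_ab lit by auto
    have t2: "t2 = b" "d = b"
      using 1 t2_cases d_cases lit uv by auto
    \<comment> \<open>Were \<open>w\<close> equal to \<open>v\<close>, then \<open>t2\<close> and
      \<open>d\<close> would also be occurrences of \<open>p\<close>, four in all.\<close>
    have "w \<noteq> v"
      using occ' lit p unfolding t1(2) t2 t1(1)
      by (auto simp: occ_constructors split: if_splits)
    then show ?thesis
      using 1 t1 t2 p lit ty ab vars_ab by auto
  next
    case 2
    have t2: "t2 = (if r = b then p else star p)" "d = t2"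
      using 2 t2_cases d_cases wv vars_ab lit by auto
    have t1: "t1 = a" "c = a"
      using 2 t1_cases c_cases lit uv by auto
    have "w \<noteq> u"
      using occ' lit p unfolding t2(2) t1 t2(1)
      by (auto simp: occ_constructors split: if_splits)
    then show ?thesis
      using 2 t1 t2 p lit ty ab vars_ab by auto
  qed
  then show ?thesis
    unfolding J pairing_def t3_eq(1) by blast
qed

text \<open>The equivalence closure takes steps both ways, hence the need for both preservation
  lemmas.\<close>

lemma pairing_alpha_equiv:
  assumes "alpha_equiv \<kappa> J J'" and "pairing \<kappa> \<alpha> s J"
  shows "pairing \<kappa> \<alpha> s J'"
  using assms unfolding alpha_equiv_def
  by (induction rule: equivclp_induct) (auto intro: pairing_alpha_step pairing_alpha_step_rev)

lemma pairing_reduces: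
  assumes "reduces \<kappa> J J'" and "pairing \<kappa> \<alpha> s J"
  shows "pairing \<kappa> \<alpha> s J'"
  using assms unfolding reduces_def
proof (induction rule: rtranclp_induct)
  case (step J1 J2)
  from step.hyps(2) step.IH[OF step.prems] show ?case
  proof cases
    case alpha
    then show ?thesis using step.IH[OF step.prems] by (rule pairing_alpha_equiv)
  \<comment> \<open>Every other rule acts on a connection, and the soup here is empty.\<close>
  qed (auto simp: pairing_def)
qed

text \<open>The context fixes the order of the components, so comparing the tensors gives
  \<open>a = b\<close>; disjointness would then leave a constant-free term without
  variables.\<close>

lemma pairing_swap_unique:
  assumes "pairing \<kappa> \<alpha> False J" and "pairing \<kappa> \<alpha> True J"
  shows False
proof -
  obtain a b where ab: "J = ([a, b] \<turnstile>\<^bsub>{||}\<^esub> a \<otimes> b)" "constant_free a" "vars a \<inter> vars b = {}"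
    using assms(1) unfolding pairing_def by (elim exE conjE) simp
  obtain c d where "J = ([c, d] \<turnstile>\<^bsub>{||}\<^esub> d \<otimes> c)"
    using assms(2) unfolding pairing_def by (elim exE conjE) simp
  with ab(1) have "a = b"
    by (metis judgement.inject list.inject trm.inject(3))
  then show False
    using ab constant_free_vars_nonempty by blast
qed

lemma derivable_pairing:
  assumes "x \<noteq> y"
  shows "derivable \<kappa> ([var x, var y] \<turnstile>\<^bsub>{||}\<^esub> var x \<otimes> var y)"
  \<comment> \<open>The right context is a single term, so its \<open>bigtensor\<close> is that term
    itself.\<close>
  using derivable.tensorR[OF derivable.Id[of \<kappa> x] derivable.Id[of \<kappa> y]] assms
  by (simp add: bigtensor_def)

theorem theorem2p8:
  fixes \<kappa> :: "'c \<Rightarrow> 'a ty"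
  shows "\<exists>(A :: 'a ty) (t1 :: ('a, 'c) trm) (t2 :: ('a, 'c) trm) \<Gamma> S1 S2.
    type_of \<kappa> t1 = A \<and> type_of \<kappa> t2 = A \<and>
    derivable \<kappa> (\<Gamma> \<turnstile>\<^bsub>S1\<^esub> t1) \<and> derivable \<kappa> (\<Gamma> \<turnstile>\<^bsub>S2\<^esub> t2) \<and>
    \<not> (\<exists>J. reduces \<kappa> (\<Gamma> \<turnstile>\<^bsub>S1\<^esub> t1) J \<and> reduces \<kappa> (\<Gamma> \<turnstile>\<^bsub>S2\<^esub> t2) J)"
proof -
  \<comment> \<open>Any atom will do, and one exists because HOL types are nonempty.\<close>
  fix \<alpha> :: 'a
  define x y :: "'a var" where "x = (0, Atom \<alpha>)" and "y = (1, Atom \<alpha>)"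
  have xy: "x \<noteq> y" "snd x = Atom \<alpha>" "snd y = Atom \<alpha>"
    by (simp_all add: x_def y_def)
  let ?J = "\<lambda>s. [var x, var y] \<turnstile>\<^bsub>{||}\<^esub> (if s then var y \<otimes> var x else var x \<otimes> var y)"
  have pairing: "pairing \<kappa> \<alpha> s (?J s)" for s
    unfolding pairing_def using xy by (intro exI[of _ "var x"] exI[of _ "var y"]) simp
  have "\<not> (\<exists>J. reduces \<kappa> (?J False) J \<and> reduces \<kappa> (?J True) J)"
  proof (rule notI, elim exE conjE)
    fix J
    assume "reduces \<kappa> (?J False) J" and "reduces \<kappa> (?J True) J"
    then show False
      by (rule pairing_swap_unique[OF pairing_reduces[OF _ pairing] pairing_reduces[OF _ pairing]])
  qed
  moreover have "derivable \<kappa> (?J False)"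
    using derivable_pairing xy by simp
  \<comment> \<open>Pair the variables in the opposite order, then exchange the context back; the
    term on the right keeps its order.\<close>
  moreover have "derivable \<kappa> (?J True)"
    using derivable.Exchange[of \<kappa> "[]" "var y" "var x" "[]"] derivable_pairing[of y x \<kappa>] xy by simp
  ultimately show ?thesis
    using xy by (intro exI[of _ "Tensor (Atom \<alpha>) (Atom \<alpha>)"] exI[of _ "var x \<otimes> var y"]
        exI[of _ "var y \<otimes> var x"] exI[of _ "[var x, var y]"] exI[of _ "{||}"]) simp
qed

end
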